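(* Let $c_1, c_2 \in \mathbb{C}$ with $c_1, c_2 \ne 0$ satisfy $c_1 \ne c_2$. Let a non-zero complex-valued random variable $Z$ satisfy $\operatorname{Range}[Z] = \{c_1, c_2\}$. (i) If $c_1$, $c_2$, $0$ are not on a common line, then the complex harmonic mean $\mathbf{H}[Z]$ moves along the arc, between $c_1$ and $c_2$ and without $0$, of the (uniquely determined) circle passing through $c_1$, $c_2$ and $0$. (ii) If $c_1$, $c_2$, $0$ are on a common line and $0$ is not on the line segment between $c_1$ and $c_2$, then the complex harmonic mean $\mathbf{H}[Z]$ moves along the line segment between $c_1$ and $c_2$.
   Context: For a complex-valued random variable $Z$, $\operatorname{Range}[Z]$ denotes the support of the distribution of $Z$. For a non-zero complex-valued (i.e. $\mathbb{C}\setminus\{0\}$-valued) random variable $Z$, the complex harmonic mean is $\mathbf{H}[Z] := \mathbf{E}[Z^{-1}]^{-1}$, defined if the expectation $\mathbf{E}[Z^{-1}]$ exists as a non-zero complex number. Lines, line segments and circles are those of the complex plane $\mathbb{C}$. "Moves along" refers to the variation of the distribution of $Z$ on the two points $c_1, c_2$: $\mathbf{E}[Z^{-1}]$ moves along the line segment between $c_1^{-1}$ and $c_2^{-1}$, and $\mathbf{H}[Z]$ is its image under the inversion $z \mapsto z^{-1}$. *)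

theory Defs
  imports "HOL-Probability.Probability"
begin

text \<open>\<open>Range[Z]\<close>: the topological support of the distribution of \<open>Z\<close>.\<close>

definition measure_support :: "complex measure \<Rightarrow> complex set" where
  "measure_support \<mu> = {z. \<forall>U. open U \<and> z \<in> U \<longrightarrow> emeasure \<mu> U > 0}"

definition rv_range :: "'a measure \<Rightarrow> ('a \<Rightarrow> complex) \<Rightarrow> complex set" where
  "rv_range M Z = measure_support (distr M borel Z)"

definition nonzero_complex_rv :: "'a measure \<Rightarrow> ('a \<Rightarrow> complex) \<Rightarrow> bool" where
  "nonzero_complex_rv M Z \<longleftrightarrow>
     prob_space M \<and> Z \<in> borel_measurable M \<and> (\<forall>\<omega>\<in>space M. Z \<omega> \<noteq> 0)"

definition harmonic_mean_defined :: "'a measure \<Rightarrow> ('a \<Rightarrow> complex) \<Rightarrow> bool" where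
  "harmonic_mean_defined M Z \<longleftrightarrow>
     integrable M (\<lambda>\<omega>. inverse (Z \<omega>)) \<and> (LINT \<omega>|M. inverse (Z \<omega>)) \<noteq> 0"

definition harmonic_mean :: "'a measure \<Rightarrow> ('a \<Rightarrow> complex) \<Rightarrow> complex" where
  "harmonic_mean M Z = inverse (LINT \<omega>|M. inverse (Z \<omega>))"

definition is_circle :: "complex set \<Rightarrow> bool" where
  "is_circle S \<longleftrightarrow> (\<exists>a r. r > 0 \<and> S = sphere a r)"

text \<open>
  The two arcs into which the points \<open>a\<close>, \<open>b\<close> divide a circle \<open>S\<close> are the connected components
  of \<open>S - {a, b}\<close>; this set collects those not containing \<open>z\<close>. Arcs exclude their endpoints.
\<close>

definition arcs_without :: "complex set \<Rightarrow> complex \<Rightarrow> complex \<Rightarrow> complex \<Rightarrow> complex set set" where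
  "arcs_without S a b z = {A \<in> components (S - {a, b}). z \<notin> A}"

text \<open>
  As the distribution of \<open>Z\<close> varies with \<open>Range[Z] = {c1, c2}\<close>, that is, as the weight \<open>t\<close> of
  \<open>c2\<close> runs through the open interval from 0 to 1, the harmonic mean is defined and runs through
  \<open>A\<close>, along a simple path from \<open>c1\<close> to \<open>c2\<close>. The endpoints are approached but not
  attained, since both points carry positive probability.

  Random variables live on arbitrary probability spaces over the type \<open>'a\<close>. That type may be too
  small to carry all the distributions in question, so those are realised on a sample space of
  complex numbers.
\<close>

definition harmonic_mean_moves_along ::
    "'a itself \<Rightarrow> complex \<Rightarrow> complex \<Rightarrow> complex set \<Rightarrow> bool" where
  "harmonic_mean_moves_along (_ :: 'a itself) c1 c2 A \<longleftrightarrow>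
     (\<exists>\<gamma> :: real \<Rightarrow> complex.
        arc \<gamma> \<and> pathstart \<gamma> = c1 \<and> pathfinish \<gamma> = c2 \<and> \<gamma> ` {0<..<1} = A \<and>
        (\<forall>(M :: 'a measure) Z. nonzero_complex_rv M Z \<and> rv_range M Z = {c1, c2} \<longrightarrow>
           harmonic_mean_defined M Z \<and>
           (\<exists>t\<in>{0<..<1}. \<P>(\<omega> in M. Z \<omega> = c2) = t \<and> harmonic_mean M Z = \<gamma> t)) \<and>
        (\<forall>t\<in>{0<..<1}. \<exists>(M :: complex measure) Z.
           nonzero_complex_rv M Z \<and> rv_range M Z = {c1, c2} \<and> harmonic_mean_defined M Z \<and>
           \<P>(\<omega> in M. Z \<omega> = c2) = t \<and> harmonic_mean M Z = \<gamma> t))"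

end

theory Submission
  imports Defs
begin

text \<open>
  A variable with range \<open>{c1, c2}\<close> satisfies \<open>E[1/Z] = (1 - t)/c1 + t/c2\<close>, where
  \<open>t = P(Z = c2)\<close> lies strictly between 0 and 1, so the harmonic mean is the image of a point
  of a segment under inversion. Inversion takes a circle through 0, with 0 removed, to the line
  through \<open>1/c1\<close> and \<open>1/c2\<close>. Removing \<open>c1\<close> and \<open>c2\<close> from the circle leaves the image of the
  open segment and the image of the two remaining rays, which are glued together at 0.
\<close>

section \<open>Random variables with two values\<close>

text \<open>The complement of the support is the union of all open null sets. This family may be
  uncountable, but the Lindelof property leaves a countable subfamily with the same union.\<close>

lemma emeasure_compl_support:
  assumes "sets \<mu> = sets borel"
  shows "emeasure \<mu> (- measure_support \<mu>) = 0"
proof -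
  define F where "F = {U. open U \<and> emeasure \<mu> U = 0}"
  have U: "- measure_support \<mu> = \<Union>F"
    unfolding measure_support_def F_def by (auto simp: zero_less_iff_neq_zero)
  obtain F' where F': "F' \<subseteq> F" "countable F'" "\<Union>F' = \<Union>F"
    using Lindelof[of F] unfolding F_def by blast
  have "(\<Union>X\<in>F'. X) \<in> null_sets \<mu>"
    by (rule null_sets_UN') (use F' assms in \<open>auto simp: F_def null_sets_def\<close>)
  then show ?thesis using U F' by auto
qed

text \<open>Each point of a two-point range is isolated in it, so lying in the support amounts to
  having positive mass. The two masses add up to 1, hence both are positive exactly if the weight of
  \<open>c2\<close> lies strictly between 0 and 1.\<close>

lemma rv_range_eq_pair_iff:
  fixes Z :: "'a \<Rightarrow> complex"
  assumes "prob_space M" and Z [measurable]: "Z \<in> borel_measurable M" and "c1 \<noteq> c2"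
  shows "rv_range M Z = {c1, c2} \<longleftrightarrow>
           (AE \<omega> in M. Z \<omega> \<in> {c1, c2}) \<and> \<P>(\<omega> in M. Z \<omega> = c2) \<in> {0<..<1}"
proof -
  interpret prob_space M by fact
  have em: "emeasure (distr M borel Z) U = prob {\<omega>\<in>space M. Z \<omega> \<in> U}" if "open U" for U
    using that
    by (subst emeasure_distr) (auto simp: emeasure_eq_measure vimage_def Int_def conj_commute)
  have prob_pair: "\<P>(\<omega> in M. Z \<omega> = c1) = 1 - \<P>(\<omega> in M. Z \<omega> = c2)"
    if "AE \<omega> in M. Z \<omega> \<in> {c1, c2}"
  proof -
    have "\<P>(\<omega> in M. Z \<omega> = c1) = \<P>(\<omega> in M. \<not> Z \<omega> = c2)"
      by (rule finite_measure_eq_AE) (use that \<open>c1 \<noteq> c2\<close> in auto)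
    also have "\<dots> = 1 - \<P>(\<omega> in M. Z \<omega> = c2)"
      by (rule prob_neg) measurable
    finally show ?thesis .
  qed
  show ?thesis
  proof (intro iffI conjI)
    assume R: "rv_range M Z = {c1, c2}"
    have "emeasure (distr M borel Z) (- {c1, c2}) = 0"
      using emeasure_compl_support[of "distr M borel Z"] R unfolding rv_range_def by simp
    moreover have "open (- {c1, c2})"
      by (intro open_Compl finite_imp_closed) auto
    ultimately have "prob {\<omega>\<in>space M. Z \<omega> \<in> - {c1, c2}} = 0"
      using em by simp
    then show AE: "AE \<omega> in M. Z \<omega> \<in> {c1, c2}"
      by (subst AE_iff_measurable[OF _ refl]) (auto simp: emeasure_eq_measure)
    have pos: "\<P>(\<omega> in M. Z \<omega> = a) > 0" if "a \<in> {c1, c2}" "b \<in> {c1, c2}" "a \<noteq> b" for a b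
    proof -
      \<comment> \<open>This neighbourhood of \<open>a\<close> avoids the other value, so almost
        surely \<open>Z\<close> lies in it only by being equal to \<open>a\<close>.\<close>
      have "open (- {b})" by auto
      moreover have "a \<in> measure_support (distr M borel Z)"
        using R that unfolding rv_range_def by auto
      ultimately have "emeasure (distr M borel Z) (- {b}) > 0"
        using that unfolding measure_support_def by blast
      then have "prob {\<omega>\<in>space M. Z \<omega> \<in> - {b}} > 0"
        by (subst (asm) em) auto
      also have "prob {\<omega>\<in>space M. Z \<omega> \<in> - {b}} = \<P>(\<omega> in M. Z \<omega> = a)"
        by (rule finite_measure_eq_AE) (use AE that in auto)
      finally show ?thesis .
    qed
    show "\<P>(\<omega> in M. Z \<omega> = c2) \<in> {0<..<1}"
      using pos[of c2 c1] pos[of c1 c2] prob_pair[OF AE] \<open>c1 \<noteq> c2\<close> by auto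
  next
    assume "(AE \<omega> in M. Z \<omega> \<in> {c1, c2}) \<and> \<P>(\<omega> in M. Z \<omega> = c2) \<in> {0<..<1}"
    then have AE: "AE \<omega> in M. Z \<omega> \<in> {c1, c2}" and t: "\<P>(\<omega> in M. Z \<omega> = c2) \<in> {0<..<1}"
      by auto
    have "z \<in> rv_range M Z" if "z \<in> {c1, c2}" for z
      unfolding rv_range_def measure_support_def
    proof (intro CollectI allI impI)
      fix U assume U: "open U \<and> z \<in> U"
      have "0 < \<P>(\<omega> in M. Z \<omega> = z)"
        using that t prob_pair[OF AE] by auto
      also have "\<dots> \<le> prob {\<omega>\<in>space M. Z \<omega> \<in> U}"
      proof (rule finite_measure_mono)
        have [measurable]: "U \<in> sets borel" using U by simp
        show "{\<omega>\<in>space M. Z \<omega> \<in> U} \<in> events" by measurable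
      qed (use U in auto)
      finally show "0 < emeasure (distr M borel Z) U"
        using U em by simp
    qed
    moreover have "z \<notin> rv_range M Z" if "z \<notin> {c1, c2}" for z
    proof -
      have op: "open (- {c1, c2})"
        by (intro open_Compl finite_imp_closed) auto
      have "AE \<omega> in M. \<not> Z \<omega> \<in> - {c1, c2}"
        using AE by auto
      then have "prob {\<omega>\<in>space M. Z \<omega> \<in> - {c1, c2}} = 0"
        using op by (subst (asm) AE_iff_measurable[OF _ refl]) (auto simp: emeasure_eq_measure)
      then have "emeasure (distr M borel Z) (- {c1, c2}) = 0"
        using em[OF op] by simp
      then show ?thesis
        using op that unfolding rv_range_def measure_support_def by force
    qed
    ultimately show "rv_range M Z = {c1, c2}" by blast
  qed
qed

text \<open>Almost everywhere \<open>f (Z \<omega>)\<close> is the constant \<open>f c1\<close>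
  corrected by \<open>f c2 - f c1\<close> on the event that \<open>Z\<close> equals
  \<open>c2\<close>, and such a step function can be integrated directly.\<close>

lemma has_bochner_integral_pair:
  fixes Z :: "'a \<Rightarrow> 'b::{second_countable_topology, t2_space}" and f :: "'b \<Rightarrow> complex"
  assumes "prob_space M" and Z [measurable]: "Z \<in> borel_measurable M"
    and [measurable]: "f \<in> borel_measurable borel"
    and "c1 \<noteq> c2" and AE: "AE \<omega> in M. Z \<omega> \<in> {c1, c2}" and t: "\<P>(\<omega> in M. Z \<omega> = c2) = t"
  shows "has_bochner_integral M (\<lambda>\<omega>. f (Z \<omega>)) (f c1 + of_real t * (f c2 - f c1))"
proof -
  interpret prob_space M by fact
  define E where "E = {\<omega>\<in>space M. Z \<omega> = c2}"
  have E [measurable]: "E \<in> sets M" unfolding E_def by measurable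
  have "has_bochner_integral M (\<lambda>\<omega>. indicator E \<omega> *\<^sub>R (f c2 - f c1))
          (measure M E *\<^sub>R (f c2 - f c1))"
    by (rule has_bochner_integral_indicator) (auto simp: emeasure_eq_measure)
  moreover have "has_bochner_integral M (\<lambda>_. f c1) (f c1)"
    by (simp add: has_bochner_integral_iff prob_space)
  ultimately have *: "has_bochner_integral M (\<lambda>\<omega>. f c1 + indicator E \<omega> *\<^sub>R (f c2 - f c1))
          (f c1 + of_real t * (f c2 - f c1))"
    using t unfolding E_def scaleR_conv_of_real[symmetric] by auto
  show ?thesis
    by (rule has_bochner_integralI_AE[OF *])
       (use AE \<open>c1 \<noteq> c2\<close> in \<open>auto simp: E_def indicator_def\<close>)
qed

section \<open>The path of harmonic means\<close>

text \<open>The parameter is the weight of \<open>c2\<close>. It ranges over all reals, not just the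
  unit interval, since values outside that interval later sweep out the rest of the circle.\<close>

definition hpath :: "complex \<Rightarrow> complex \<Rightarrow> real \<Rightarrow> complex" where
  "hpath c1 c2 t = inverse (inverse c1 + of_real t * (inverse c2 - inverse c1))"

lemma exists_two_point_rv:
  assumes "c1 \<noteq> 0" "c2 \<noteq> 0" "c1 \<noteq> c2" and t: "t \<in> {0<..<1::real}"
  shows "\<exists>(M :: complex measure) Z.
           nonzero_complex_rv M Z \<and> rv_range M Z = {c1, c2} \<and> \<P>(\<omega> in M. Z \<omega> = c2) = t"
proof -
  define p where "p = map_pmf (\<lambda>b. if b then c2 else c1) (bernoulli_pmf t)"
  \<comment> \<open>Not the identity: the sample space is all of the complex plane, and a non-zero
    variable must avoid 0 even on null sets.\<close>
  define Z where "Z = (\<lambda>\<omega>. if \<omega> = c2 then c2 else c1)"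
  have pr: "prob_space (measure_pmf p)" by (rule prob_space_measure_pmf)
  have Z: "Z \<in> borel_measurable (measure_pmf p)" by simp
  have "measure_pmf.prob p {\<omega>. Z \<omega> = c2} = measure_pmf.prob (bernoulli_pmf t) {True}"
    using \<open>c1 \<noteq> c2\<close> unfolding p_def Z_def
    by (subst measure_map_pmf) (auto intro!: arg_cong[where f = "measure _"])
  also have "\<dots> = t" using t by (simp add: measure_pmf_single)
  finally have P: "\<P>(\<omega> in measure_pmf p. Z \<omega> = c2) = t" by simp
  have "AE \<omega> in measure_pmf p. Z \<omega> \<in> {c1, c2}" unfolding Z_def by auto
  then have "rv_range (measure_pmf p) Z = {c1, c2}"
    using rv_range_eq_pair_iff[OF pr Z \<open>c1 \<noteq> c2\<close>] P t by simp
  moreover have "nonzero_complex_rv (measure_pmf p) Z"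
    using pr Z assms unfolding nonzero_complex_rv_def by (auto simp: Z_def)
  ultimately show ?thesis using P by blast
qed

text \<open>Common to both cases of the theorem: only the identification of the image is left to
  each of them. The hypothesis covers the closed interval because the path must be continuous up to
  its endpoints.\<close>

lemma moves_along_hpath:
  assumes "c1 \<noteq> 0" "c2 \<noteq> 0" "c1 \<noteq> c2"
    and nz: "\<And>t. t \<in> {0..1} \<Longrightarrow> inverse c1 + of_real t * (inverse c2 - inverse c1) \<noteq> 0"
  shows "harmonic_mean_moves_along TYPE('a) c1 c2 (hpath c1 c2 ` {0<..<1})"
proof -
  \<comment> \<open>The sample type \<open>'b\<close> is kept general, since the fact is applied
    both to arbitrary spaces over \<open>'a\<close> and to the witnesses over the complex
    numbers.\<close>
  have mean: "harmonic_mean_defined M Z \<and>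
      (\<exists>t\<in>{0<..<1}. \<P>(\<omega> in M. Z \<omega> = c2) = t \<and> harmonic_mean M Z = hpath c1 c2 t)"
    if rv: "nonzero_complex_rv M Z" and R: "rv_range M Z = {c1, c2}" for M :: "'b measure" and Z
  proof -
    have M: "prob_space M" "Z \<in> borel_measurable M"
      using rv unfolding nonzero_complex_rv_def by auto
    define t where "t = \<P>(\<omega> in M. Z \<omega> = c2)"
    have AE: "AE \<omega> in M. Z \<omega> \<in> {c1, c2}" and t: "t \<in> {0<..<1}"
      using R rv_range_eq_pair_iff[OF M \<open>c1 \<noteq> c2\<close>] unfolding t_def by blast+
    have "has_bochner_integral M (\<lambda>\<omega>. inverse (Z \<omega>))
            (inverse c1 + of_real t * (inverse c2 - inverse c1))"
      by (rule has_bochner_integral_pair[OF M _ \<open>c1 \<noteq> c2\<close> AE t_def[symmetric]]) simp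
    then show ?thesis
      using nz[of t] t
      unfolding harmonic_mean_defined_def harmonic_mean_def hpath_def t_def[symmetric]
      by (auto simp: has_bochner_integral_iff)
  qed
  have "arc (hpath c1 c2)"
    unfolding arc_def path_def
  proof
    show "continuous_on {0..1} (hpath c1 c2)"
      unfolding hpath_def by (intro continuous_intros) (use nz in auto)
    show "inj_on (hpath c1 c2) {0..1}"
      using \<open>c1 \<noteq> c2\<close> by (auto simp: inj_on_def hpath_def)
  qed
  moreover have "pathstart (hpath c1 c2) = c1" "pathfinish (hpath c1 c2) = c2"
    by (auto simp: pathstart_def pathfinish_def hpath_def)
  moreover have "\<exists>(M :: complex measure) Z.
           nonzero_complex_rv M Z \<and> rv_range M Z = {c1, c2} \<and> harmonic_mean_defined M Z \<and>
           \<P>(\<omega> in M. Z \<omega> = c2) = t \<and> harmonic_mean M Z = hpath c1 c2 t"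
    if "t \<in> {0<..<1}" for t
    using exists_two_point_rv[OF assms(1-3) that] mean by metis
  ultimately show ?thesis
    unfolding harmonic_mean_moves_along_def using mean by blast
qed

text \<open>All reciprocals involved are real multiples of \<open>inverse c2\<close>, with factor
  \<open>((1 - t) + t * r) / r\<close>. The numerator is a convex combination of 1 and
  \<open>r\<close>, hence positive.\<close>

lemma hpath_collinear:
  assumes "c2 \<noteq> 0" "c1 = of_real r * c2" "r > 0" "t \<in> {0..1}"
  shows "inverse c1 + of_real t * (inverse c2 - inverse c1) \<noteq> 0"
    and "hpath c1 c2 t = of_real (r / ((1 - t) + t * r)) * c2"
proof -
  have "(1 - t) + t * r > 0"
    using assms by (cases "t = 0") (auto intro: add_nonneg_pos)
  then have d: "(1 - t) + t * r \<noteq> 0" by simp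
  have *: "inverse c1 + of_real t * (inverse c2 - inverse c1)
          = of_real (((1 - t) + t * r) / r) * inverse c2"
    using assms by (simp add: field_simps)
  show "inverse c1 + of_real t * (inverse c2 - inverse c1) \<noteq> 0"
    and "hpath c1 c2 t = of_real (r / ((1 - t) + t * r)) * c2"
    using assms(1,3) d unfolding hpath_def *
    by (simp_all del: of_real_add of_real_diff of_real_mult of_real_divide add: of_real_inverse[symmetric])
qed

lemma hpath_image_collinear:
  assumes "c2 \<noteq> 0" "c1 = of_real r * c2" "r > 0" "c1 \<noteq> c2"
  shows "hpath c1 c2 ` {0<..<1} = open_segment c1 c2"
proof (intro equalityI subsetI)
  fix z assume "z \<in> hpath c1 c2 ` {0<..<1}"
  then obtain t where t: "0 < t" "t < 1" "z = hpath c1 c2 t" by auto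
  define d where "d = (1 - t) + t * r"
  have "t * r > 0" using t \<open>r > 0\<close> by simp
  then have d: "d > 0" "r * t < d" using t unfolding d_def by (auto simp: mult.commute)
  \<comment> \<open>The weight \<open>t\<close> is not the position on the segment: \<open>u\<close>
    solves \<open>(1 - u) * r + u = r / d\<close>, an equation between coordinates relative to
    \<open>c2\<close>.\<close>
  define u where "u = r * t / d"
  have "0 < u" "u < 1" using d t \<open>r > 0\<close> by (auto simp: u_def)
  moreover have "r / d = (1 - u) * r + u"
    using d by (simp add: u_def field_simps) (simp add: d_def algebra_simps)
  then have "z = of_real ((1 - u) * r + u) * c2"
    using hpath_collinear(2)[OF assms(1-3), of t] t by (simp add: d_def)
  then have "z = (1 - u) *\<^sub>R c1 + u *\<^sub>R c2"
    using assms(2) by (simp add: scaleR_conv_of_real algebra_simps)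
  ultimately show "z \<in> open_segment c1 c2"
    using \<open>c1 \<noteq> c2\<close> by (auto simp: in_segment)
next
  fix z assume "z \<in> open_segment c1 c2"
  then obtain u where u: "0 < u" "u < 1" "z = (1 - u) *\<^sub>R c1 + u *\<^sub>R c2"
    by (auto simp: in_segment)
  define e where "e = r * (1 - u) + u"
  have e: "e > 0" "u < e" using u \<open>r > 0\<close> by (auto simp: e_def add_pos_pos)
  \<comment> \<open>Inverse of the change of parameter above; \<open>e\<close> is the coordinate of
    \<open>z\<close> relative to \<open>c2\<close>.\<close>
  define t where "t = u / e"
  have t: "0 < t" "t < 1" using e u by (auto simp: t_def)
  have "(1 - t) + t * r = r / e"
    using e by (simp add: t_def field_simps) (simp add: e_def algebra_simps)
  then have "r / ((1 - t) + t * r) = e" using \<open>r > 0\<close> e by simp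
  then have "hpath c1 c2 t = of_real e * c2"
    using hpath_collinear(2)[OF assms(1-3), of t] t by simp
  also have "\<dots> = z"
    using u(3) assms(2) by (simp add: e_def scaleR_conv_of_real algebra_simps)
  finally have "hpath c1 c2 t = z" .
  then show "z \<in> hpath c1 c2 ` {0<..<1}" using t by force
qed

section \<open>Circles through the origin\<close>

text \<open>Expanding the squared distance from \<open>a\<close> to \<open>z\<close> cancels the
  squared norm of \<open>a\<close>; dividing by the squared norm of \<open>z\<close> leaves a real
  linear equation in \<open>inverse z\<close>. This is how inversion turns a circle through 0 into a
  line.\<close>

lemma mem_sphere_origin_iff:
  fixes a z :: complex
  assumes "z \<noteq> 0"
  shows "z \<in> sphere a (norm a) \<longleftrightarrow> Re (a * inverse z) = 1/2"
proof -
  define d where "d = (Re z)\<^sup>2 + (Im z)\<^sup>2"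
  have "d > 0" using assms by (simp add: d_def complex_neq_0)
  have "Re (a * inverse z) = (Re a * Re z + Im a * Im z) / d"
    by (simp add: d_def add_divide_distrib)
  also have "\<dots> = 1/2 \<longleftrightarrow> d = 2 * (Re a * Re z + Im a * Im z)"
    using \<open>d > 0\<close> by (auto simp: field_simps)
  also have "\<dots> \<longleftrightarrow> (norm (a - z))\<^sup>2 = (norm a)\<^sup>2"
    unfolding cmod_power2 d_def by (auto simp: power2_eq_square algebra_simps)
  finally have "(norm (a - z))\<^sup>2 = (norm a)\<^sup>2 \<longleftrightarrow> Re (a * inverse z) = 1/2" by simp
  then show ?thesis by (simp add: dist_norm)
qed

text \<open>Two real linear equations for \<open>Re a\<close> and \<open>Im a\<close>, whose
  determinant is, up to sign, the assumed non-zero quantity. The witness comes from Cramer's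
  rule.\<close>

lemma ex1_Re_mult_eq_half:
  assumes "Im (cnj w1 * w2) \<noteq> 0"
  shows "\<exists>!a. Re (a * w1) = 1/2 \<and> Re (a * w2) = 1/2"
proof -
  define D where "D = Im (cnj w1 * w2)"
  have D: "D \<noteq> 0" "D = Re w1 * Im w2 - Im w1 * Re w2" using assms by (auto simp: D_def)
  define a where "a = Complex ((Im w2 - Im w1) / (2 * D)) ((Re w2 - Re w1) / (2 * D))"
  show ?thesis
  proof (rule ex1I[of _ a])
    show "Re (a * w1) = 1/2 \<and> Re (a * w2) = 1/2"
      using D(1) by (simp add: a_def field_simps) (simp add: D(2) algebra_simps)
  next
    fix b assume b: "Re (b * w1) = 1/2 \<and> Re (b * w2) = 1/2"
    have "Re b * D = (Im w2 - Im w1) / 2" "Im b * D = (Re w2 - Re w1) / 2"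
      using b unfolding D(2) by (simp_all, algebra+)
    then show "b = a" using D(1) by (simp add: a_def complex_eq_iff field_simps)
  qed
qed

text \<open>Collinearity with 0 means that \<open>c1 / c2\<close> is real, and this quotient is a
  positive multiple of \<open>cnj (inverse c1) * inverse c2\<close>. The reciprocals are used so as
  to match the determinant above.\<close>

lemma collinear_0_iff_Im:
  assumes "c1 \<noteq> 0" "c2 \<noteq> 0"
  shows "collinear {c1, c2, 0} \<longleftrightarrow> Im (cnj (inverse c1) * inverse c2) = 0"
proof -
  have "collinear {c1, c2, 0} \<longleftrightarrow> (\<exists>k. c1 = of_real k * c2)"
    using collinear_lemma[of c2 c1] assms
    by (simp add: insert_commute scaleR_conv_of_real)
  also have "\<dots> \<longleftrightarrow> c1 / c2 \<in> \<real>"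
    using assms by (auto simp: Reals_def field_simps)
  also have "\<dots> \<longleftrightarrow> Im (c1 / c2) = 0"
    by (simp add: complex_is_Real_iff)
  also have "c1 / c2 = of_real ((norm c1)\<^sup>2) * (cnj (inverse c1) * inverse c2)"
    using assms by (simp add: complex_norm_square field_simps del: of_real_power)
  also have "Im \<dots> = 0 \<longleftrightarrow> Im (cnj (inverse c1) * inverse c2) = 0"
    using assms by (simp del: of_real_power)
  finally show ?thesis .
qed

lemma circle_0_iff: "is_circle S \<and> 0 \<in> S \<longleftrightarrow> (\<exists>a. a \<noteq> 0 \<and> S = sphere a (norm a))"
proof
  assume "\<exists>a. a \<noteq> 0 \<and> S = sphere a (norm a)"
  then obtain a where a: "a \<noteq> 0" "S = sphere a (norm a)" by auto
  have "is_circle S"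
    unfolding is_circle_def by (intro exI conjI, rule zero_less_norm_iff[THEN iffD2]) (fact a)+
  then show "is_circle S \<and> 0 \<in> S" using a(2) by (simp add: dist_norm)
qed (auto simp: is_circle_def dist_norm)

lemma ex1_circle_0:
  assumes nc: "\<not> collinear {c1, c2, 0}"
  shows "\<exists>!S. is_circle S \<and> {c1, c2, 0} \<subseteq> S"
proof -
  have nz: "c1 \<noteq> 0" "c2 \<noteq> 0" using nc by (auto simp: insert_commute)
  let ?P = "\<lambda>a. Re (a * inverse c1) = 1/2 \<and> Re (a * inverse c2) = 1/2"
  have P: "\<exists>!a. ?P a"
    by (rule ex1_Re_mult_eq_half) (use nc collinear_0_iff_Im[OF nz] in blast)
  have "is_circle S \<and> {c1, c2, 0} \<subseteq> S \<longleftrightarrow> (\<exists>a. ?P a \<and> S = sphere a (norm a))" for S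
  proof -
    have "is_circle S \<and> {c1, c2, 0} \<subseteq> S \<longleftrightarrow> (is_circle S \<and> 0 \<in> S) \<and> c1 \<in> S \<and> c2 \<in> S"
      by auto
    also have "\<dots> \<longleftrightarrow> (\<exists>a. a \<noteq> 0 \<and> ?P a \<and> S = sphere a (norm a))"
      unfolding circle_0_iff
      by (auto simp only: mem_sphere_origin_iff[OF nz(1)] mem_sphere_origin_iff[OF nz(2)])
    also have "\<dots> \<longleftrightarrow> (\<exists>a. ?P a \<and> S = sphere a (norm a))"
    proof -
      \<comment> \<open>A zero centre would turn the equations into 0 = 1/2.\<close>
      have "a \<noteq> 0" if "?P a" for a using that by auto
      then show ?thesis by blast
    qed
    finally show ?thesis .
  qed
  then show ?thesis using P by metis
qed

section \<open>The arcs of a circle through the origin\<close>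

locale circle_through_0 =
  fixes c1 c2 a :: complex and S :: "complex set"
  assumes noncollinear: "\<not> collinear {c1, c2, 0}"
    and S_eq: "S = sphere a (norm a)" and a_nonzero: "a \<noteq> 0"
    and c_in: "c1 \<in> S" "c2 \<in> S"
begin

lemma nonzero: "c1 \<noteq> 0" "c2 \<noteq> 0" and distinct: "c1 \<noteq> c2"
  using noncollinear by (auto simp: insert_commute)

definition line :: "real \<Rightarrow> complex" where
  "line t = inverse c1 + of_real t * (inverse c2 - inverse c1)"

lemma hpath_eq: "hpath c1 c2 t = inverse (line t)"
  by (simp add: hpath_def line_def)

lemma Im_nonzero: "Im (cnj (inverse c1) * inverse c2) \<noteq> 0"
  using noncollinear collinear_0_iff_Im[OF nonzero] by blast

text \<open>The reciprocals are linearly independent over the reals: elimination shows that the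
  determinant annihilates both coefficients.\<close>

lemma combination_nonzero:
  assumes "s \<noteq> 0 \<or> t \<noteq> (0::real)"
  shows "of_real s * inverse c1 + of_real t * inverse c2 \<noteq> 0"
proof
  assume *: "of_real s * inverse c1 + of_real t * inverse c2 = 0"
  define w1 where "w1 = inverse c1"
  define w2 where "w2 = inverse c2"
  have "s * Re w1 + t * Re w2 = 0" "s * Im w1 + t * Im w2 = 0"
    using * unfolding w1_def[symmetric] w2_def[symmetric] by (auto simp: complex_eq_iff)
  then have "s * (Re w1 * Im w2 - Im w1 * Re w2) = 0" "t * (Re w1 * Im w2 - Im w1 * Re w2) = 0"
    by algebra+
  then show False
    using Im_nonzero assms unfolding w1_def[symmetric] w2_def[symmetric] by simp
qed

lemma line_nonzero: "line t \<noteq> 0"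
  using combination_nonzero[of "1 - t" t] by (simp add: line_def algebra_simps)

lemma inj_hpath: "hpath c1 c2 s = hpath c1 c2 t \<longleftrightarrow> s = t"
  using distinct by (simp add: hpath_def)

lemma hpath_0_1: "hpath c1 c2 0 = c1" "hpath c1 c2 1 = c2"
  by (simp_all add: hpath_def)

lemma continuous_hpath: "continuous_on T (hpath c1 c2)"
  unfolding hpath_def
  by (intro continuous_intros) (use line_nonzero in \<open>auto simp: line_def\<close>)

text \<open>Inversion matches the circle without 0 with the whole line through the reciprocals. The
  origin corresponds to the point at infinity of that line and is added separately.\<close>

lemma S_param: "S = insert 0 (range (hpath c1 c2))"
proof -
  have h: "Re (a * inverse c1) = 1/2" "Re (a * inverse c2) = 1/2"
    using c_in nonzero mem_sphere_origin_iff unfolding S_eq by blast+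
  have 1: "hpath c1 c2 t \<in> S" for t
  proof -
    have "Re (a * line t) = Re (a * inverse c1) + t * (Re (a * inverse c2) - Re (a * inverse c1))"
      unfolding line_def by (simp add: algebra_simps)
    also have "\<dots> = 1/2" unfolding h by simp
    finally show ?thesis
      using mem_sphere_origin_iff[of "hpath c1 c2 t" a] line_nonzero[of t]
      unfolding S_eq hpath_eq by (simp del: times_complex.sel)
  qed
  have 2: "z \<in> range (hpath c1 c2)" if "z \<in> S" "z \<noteq> 0" for z
  proof -
    \<comment> \<open>The candidate parameter of \<open>z\<close>. It is real because multiplying
      numerator and denominator by \<open>a\<close> makes both purely imaginary.\<close>
    define q where "q = (inverse z - inverse c1) / (inverse c2 - inverse c1)"
    have d: "inverse c2 - inverse c1 \<noteq> 0" using distinct by simp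
    have imaginary_div: "u / v \<in> \<real>" if "Re u = 0" "Re v = 0" for u v
      using that by (simp add: complex_is_Real_iff Im_divide)
    have "Re (a * (inverse z - inverse c1)) = 0" "Re (a * (inverse c2 - inverse c1)) = 0"
      using that mem_sphere_origin_iff[of z a] h unfolding S_eq right_diff_distrib minus_complex.sel by linarith+
    then have "(a * (inverse z - inverse c1)) / (a * (inverse c2 - inverse c1)) \<in> \<real>"
      by (rule imaginary_div)
    then have "q \<in> \<real>" using a_nonzero by (simp add: q_def)
    then obtain t where "q = of_real t" by (auto elim: Reals_cases)
    then have "inverse z - inverse c1 = of_real t * (inverse c2 - inverse c1)"
      using d unfolding q_def by (metis nonzero_divide_eq_eq)
    then have "line t = inverse z" by (simp add: line_def algebra_simps)
    then have "hpath c1 c2 t = z" by (simp add: hpath_eq)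
    then show ?thesis by blast
  qed
  have "0 \<in> S" by (simp add: S_eq)
  then show ?thesis using 1 2 by blast
qed

abbreviation (input) arc_A where "arc_A \<equiv> hpath c1 c2 ` {0<..<1}"

lemma S_minus_eq: "S - {c1, c2} = insert 0 (hpath c1 c2 ` (- {0, 1}))"
  using inj_hpath hpath_0_1 nonzero unfolding S_param by (auto; metis)

lemma hpath_nonzero: "hpath c1 c2 t \<noteq> 0"
  using line_nonzero by (simp add: hpath_eq)

text \<open>The substitution \<open>t = 1/s\<close> removes the pole of the parametrisation at 0.\<close>

lemma connected_complementary_arc: "connected (S - {c1, c2} - arc_A)"
proof -
  define h :: "real \<Rightarrow> complex" where
    "h s = of_real s / (of_real s * inverse c1 + (inverse c2 - inverse c1))" for s
  \<comment> \<open>The denominator is a combination of the reciprocals in which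
    \<open>inverse c2\<close> has coefficient 1.\<close>
  have nz: "of_real s * inverse c1 + (inverse c2 - inverse c1) \<noteq> 0" for s :: real
    using combination_nonzero[of "s - 1" 1] by (simp add: algebra_simps)
  have h: "h s = hpath c1 c2 (1 / s)" if "s \<noteq> 0" for s
  proof -
    have "of_real s * line (1 / s) = of_real s * inverse c1 + (inverse c2 - inverse c1)"
      using that by (simp add: line_def distrib_left)
    then have "h s = of_real s / (of_real s * line (1 / s))" by (simp only: h_def)
    then show ?thesis using that by (simp add: hpath_eq divide_inverse)
  qed
  have "S - {c1, c2} - arc_A = insert 0 (hpath c1 c2 ` ({..<0} \<union> {1<..}))"
    unfolding S_minus_eq using inj_hpath hpath_nonzero by (auto simp: image_iff)
  \<comment> \<open>With \<open>t = 1/s\<close>, negative \<open>s\<close> gives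
    \<open>t < 0\<close>, \<open>s\<close> between 0 and 1 gives \<open>t > 1\<close>, and
    \<open>s = 0\<close> gives the origin, which joins the two rays.\<close>
  also have "\<dots> = h ` {..<1}"
  proof (intro equalityI subsetI)
    fix z assume "z \<in> insert 0 (hpath c1 c2 ` ({..<0} \<union> {1<..}))"
    then consider "z = 0" | t where "t < 0 \<or> t > 1" "z = hpath c1 c2 t" by auto
    then show "z \<in> h ` {..<1}"
    proof cases
      case 1
      then have "z = h 0" by (simp add: h_def)
      then show ?thesis by auto
    next
      case 2
      then have "z = h (1 / t)" "1 / t < 1" using h[of "1 / t"] by (auto simp: field_simps)
      then show ?thesis by blast
    qed
  next
    fix z assume "z \<in> h ` {..<1}"
    then obtain s where s: "s < 1" "z = h s" by auto
    show "z \<in> insert 0 (hpath c1 c2 ` ({..<0} \<union> {1<..}))"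
    proof (cases "s = 0")
      case False
      then have "1 / s < 0 \<or> 1 / s > 1" using s(1) by (cases "s < 0") auto
      then show ?thesis using h[OF False] s(2) by auto
    qed (use s in \<open>simp add: h_def\<close>)
  qed
  finally show ?thesis
    unfolding h_def
    by (auto intro!: connected_continuous_image continuous_intros simp: nz)
qed

text \<open>The function \<open>q\<close> recovers the parameter continuously away from 0, so the
  arc is cut out by the preimage of an open interval. Taking the real part makes \<open>q\<close>
  real-valued off the circle too.\<close>

lemma openin_arc: "openin (top_of_set (S - {c1, c2})) arc_A"
proof -
  define q where "q z = Re ((inverse z - inverse c1) / (inverse c2 - inverse c1))" for z
  have q: "q (hpath c1 c2 t) = t" for t
    using distinct by (simp add: q_def hpath_eq line_def)
  have "continuous_on (- {0}) q"
    unfolding q_def using distinct by (intro continuous_intros) auto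
  then have "open (- {0} \<inter> q -` {0<..<1})"
    by (intro continuous_open_preimage) auto
  moreover have "arc_A = (S - {c1, c2}) \<inter> (- {0} \<inter> q -` {0<..<1})"
    unfolding S_minus_eq using hpath_nonzero q by auto
  ultimately show ?thesis by (metis openin_open_Int)
qed

text \<open>Adding the two endpoints gives a compact set, and exactly these endpoints are missing
  from the subspace.\<close>

lemma closedin_arc: "closedin (top_of_set (S - {c1, c2})) arc_A"
proof -
  have "closed (hpath c1 c2 ` {0..1})"
    by (intro compact_imp_closed compact_continuous_image continuous_hpath) auto
  moreover have "arc_A = (S - {c1, c2}) \<inter> hpath c1 c2 ` {0..1}"
    unfolding S_minus_eq using hpath_nonzero inj_hpath by (force simp: image_iff)
  ultimately show ?thesis by (metis closedin_closed_Int)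
qed

text \<open>Being connected and clopen, the arc is a component. What remains is connected and
  contains 0, so any other component absorbs it and contains 0.\<close>

lemma arcs_without_0: "arcs_without S c1 c2 0 = {arc_A}"
proof -
  let ?U = "S - {c1, c2}"
  have sub: "arc_A \<subseteq> ?U" unfolding S_minus_eq by auto
  have conn: "connected arc_A"
    by (intro connected_continuous_image continuous_hpath) auto
  have ne: "hpath c1 c2 (1/2) \<in> arc_A" by auto
  have maximal: "C = arc_A" if "C \<subseteq> ?U" "connected C" "arc_A \<subseteq> C" for C
  proof -
    have "openin (top_of_set C) arc_A" "closedin (top_of_set C) arc_A"
      using openin_arc closedin_arc that openin_subset_trans closedin_subset_trans by blast+
    then show ?thesis using \<open>connected C\<close> ne unfolding connected_clopen by blast
  qed
  then have A: "arc_A \<in> components ?U"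
    unfolding in_components_maximal using sub conn ne by blast
  have "C = arc_A" if C: "C \<in> components ?U" "0 \<notin> C" for C
  proof (rule ccontr)
    assume "C \<noteq> arc_A"
    then have "C \<inter> arc_A = {}" using components_nonoverlap[OF C(1) A] by blast
    then have "C \<inter> (?U - arc_A) \<noteq> {}"
      using in_components_nonempty[OF C(1)] in_components_subset[OF C(1)] by blast
    then have "?U - arc_A \<subseteq> C"
      using components_maximal[OF C(1) connected_complementary_arc] by blast
    moreover have "0 \<in> ?U - arc_A" unfolding S_minus_eq using hpath_nonzero by force
    ultimately show False using C(2) by blast
  qed
  moreover have "0 \<notin> arc_A" using hpath_nonzero by force
  ultimately show ?thesis using A unfolding arcs_without_def by blast
qed

end

theorem theorem6p1:
  fixes c1 c2 :: complex
  assumes "c1 \<noteq> 0" and "c2 \<noteq> 0" and "c1 \<noteq> c2"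
  shows "(\<not> collinear {c1, c2, 0} \<longrightarrow>
            (\<exists>!S. is_circle S \<and> {c1, c2, 0} \<subseteq> S) \<and>
            (\<forall>S. is_circle S \<and> {c1, c2, 0} \<subseteq> S \<longrightarrow>
               (\<exists>A. arcs_without S c1 c2 0 = {A} \<and>
                    harmonic_mean_moves_along TYPE('a) c1 c2 A))) \<and>
         (collinear {c1, c2, 0} \<and> 0 \<notin> closed_segment c1 c2 \<longrightarrow>
            harmonic_mean_moves_along TYPE('a) c1 c2 (open_segment c1 c2))"
proof (intro conjI impI allI)
  assume nc: "\<not> collinear {c1, c2, 0}"
  then show "\<exists>!S. is_circle S \<and> {c1, c2, 0} \<subseteq> S"
    by (rule ex1_circle_0)
  fix S assume S: "is_circle S \<and> {c1, c2, 0} \<subseteq> S"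
  then obtain a where a: "a \<noteq> 0" "S = sphere a (norm a)"
    using circle_0_iff[of S] by auto
  interpret circle_through_0 c1 c2 a S
    using nc a S by unfold_locales auto
  show "\<exists>A. arcs_without S c1 c2 0 = {A} \<and> harmonic_mean_moves_along TYPE('a) c1 c2 A"
    using arcs_without_0 moves_along_hpath[OF assms] line_nonzero unfolding line_def by blast
next
  assume c: "collinear {c1, c2, 0} \<and> 0 \<notin> closed_segment c1 c2"
  then obtain r where r: "c1 = of_real r * c2"
    using collinear_lemma[of c2 c1] assms
    by (auto simp: insert_commute scaleR_conv_of_real)
  have "r > 0"
  proof (rule ccontr)
    assume "\<not> r > 0"
    then have r0: "1 - r > 0" "r \<le> 0" by auto
    \<comment> \<open>The root of \<open>(1 - u) * r + u = 0\<close>, that is, the position at which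
      the segment would pass through 0.\<close>
    define u where "u = - r / (1 - r)"
    have "0 \<le> u" "u \<le> 1" using r0 by (auto simp: u_def field_simps)
    moreover have "(1 - u) * r + u = 0" using r0 by (simp add: u_def field_simps)
    then have "(1 - u) *\<^sub>R c1 + u *\<^sub>R c2 = 0"
      unfolding r scaleR_conv_of_real
      by (metis (no_types) distrib_right mult.assoc mult_zero_left of_real_0 of_real_add of_real_mult)
    ultimately show False using c by (metis in_segment(1))
  qed
  then show "harmonic_mean_moves_along TYPE('a) c1 c2 (open_segment c1 c2)"
    using moves_along_hpath[OF assms] hpath_collinear(1)[OF assms(2) r]
      hpath_image_collinear[OF assms(2) r _ assms(3)] by metis
qed

end
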